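(* Let $P$ be a well-founded poset, $(C,d)$ a finite-dimensional $P$-graded chain complex of vector spaces over a field $k$ with chosen totally ordered bases $\mathfrak A^p_n$ of $C^p_n$, and let $(\mathfrak H^p,\mathfrak B^p,\mathfrak K^p)$ be a separating basis for $C^p$ for every $p\in P$. Let $\Delta$ be the connection matrix given as the matrix of the Conley differential $\bar d=\alpha\mathcal S\beta$ with respect to the basis $\zeta(\mathfrak H)$ of $\bar C=\bigoplus_{p,n}H^p_n$. For $z_i,z_j\in\mathfrak H$, let $\Delta_{i,j}\in k$ be the entry of $\Delta$ in the row of $\zeta(z_i)$ and the column of $\zeta(z_j)$. Then $$\Delta_{i,j}\,\zeta(z_i)=\theta\,\jmath_{\rho(z_i)}\,d(1+\gamma\mathcal S)\beta(\zeta(z_j)),$$ where $\jmath_{\rho(z_i)}\colon C\to\langle\rho(z_i)\rangle$ is the coordinate projection onto the basis element $\rho(z_i)\in\mathfrak A$; i.e. $\Delta_{i,j}$ is the coefficient of the basis element $\rho(z_i)$ in the chain $d(1+\gamma\mathcal S)\beta(\zeta(z_j))$.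
   Context: $P$ is well-founded: no infinite strictly descending sequence. Complexes are $\mathbb Z$-indexed, $d_n\colon C_n\to C_{n-1}$, and the total space $\bigoplus_nC_n$ is finite-dimensional. $(C,d)$ is $P$-graded: $C_n=\bigoplus_pC^p_n$ with inclusions $\imath^p$ and projections $\jmath^p$, and $\jmath^pd\imath^q\ne0$ implies $p\le q$. Put $t^{pq}=\jmath^pd\imath^q$, $t^p=t^{pp}$; $(C^p,t^p)$ is the relative complex at $p$, with $B^p_n=\operatorname{im}t^p_{n+1}$, $K^p_n:=B^p_{n-1}$, $H^p_n=H_n(C^p)=\ker t_n^p/B^p_n$. $\mathfrak A=\bigsqcup_{p,n}\mathfrak A^p_n$ is the basis of $C$. For a vector $v=\sum_uv_uu$ written in an ordered basis, the pivot $\rho(v)$ is the maximal $u$ with $v_u\ne0$; $\rho(W)=\{\rho(v):v\in W\}$ for a set $W$ of vectors. Angle brackets denote span. Separating basis for $C^p$ (with respect to $\mathfrak A^p$): for each $n$, a basis $\mathfrak H^p_n\sqcup\mathfrak B^p_n\sqcup\mathfrak K^p_n$ of $C^p_n$, with pairwise distinct pivots in $\mathfrak A^p_n$, such that $\mathfrak B^p_n$ is a basis of $B^p_n$, $\mathfrak H^p_n\sqcup\mathfrak B^p_n$ is a basis of $\ker t^p_n$, $t^p_n$ restricts to a bijection $\mathfrak K^p_n\to\mathfrak B^p_{n-1}$, and: (S1) for all $z\in\mathfrak H^p_n$, $w\in\mathfrak K^p_n$ and $b\in\rho(\mathfrak B^p_n)$, $z_b=w_b=0$; (S2) for all $z\in\mathfrak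 H^p_n$, $v\in\mathfrak H^p_n\setminus\{z\}$, $w\in\mathfrak K^p_n$: $v_{\rho(z)}=w_{\rho(z)}=0$; (S3) $z_{\rho(z)}=1$ for all $z\in\mathfrak H^p_n$. Here subscripts denote coordinates in $\mathfrak A^p_n$. Write $\mathfrak H=\bigsqcup_{p,n}\mathfrak H^p_n$, and similarly $\mathfrak B$, $\mathfrak K$. Associated isomorphisms $\zeta^p_n\colon C^p_n\to H^p_n\oplus B^p_n\oplus K^p_n$: $z\mapsto[z]$ for $z\in\mathfrak H^p_n$, $b\mapsto b$ for $b\in\mathfrak B^p_n$, $w\mapsto t^p_n(w)\in B^p_{n-1}=K^p_n$ for $w\in\mathfrak K^p_n$. Let $\zeta$ be their direct sum and $\zeta(\mathfrak H)=\{\zeta(z):z\in\mathfrak H\}$, a basis of $\bar C$. The map $\theta\colon\langle\rho(\mathfrak H)\rangle\to\bigoplus_{p,n}H^p_n$ is the isomorphism with $\theta(\rho(z))=\zeta(z)$. $\alpha\colon C\to\bar C$ is $\zeta$ followed by projection to the $H$-summands; $\beta\colon\bar C\to C$ is inclusion followed by $\zeta^{-1}$ (so $\beta(\zeta(z))=z$ for $z\in\mathfrak H$); $\gamma\colon C_n\to C_{n+1}$ is the direct sum over $p$ of $-1$ times the composites of $\zeta^p_n$, projection to $B^p_n=K^p_{n+1}$, inclusion into $H^p_{n+1}\oplus B^p_{n+1}\oplus K^p_{n+1}$, and $(\zeta^p_{n+1})^{-1}$. Let $\widehat d=\sum_p\imath^pt^p\jmath^p$, $\delta=d-\widehat d$,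 $\mathcal S=\delta(1-\gamma\delta)^{-1}=\sum_{i\ge0}\delta(\gamma\delta)^i$. The pair $(\bar C,\bar d)$, $\bar d=\alpha\mathcal S\beta$, is the Conley complex and a connection matrix is a matrix representing $\bar d$. *)

theory Defs
  imports "HOL.Vector_Spaces" "HOL-Library.Set_Algebras"
begin

text \<open>
  The total space \<open>C = \<Oplus>\<^sub>n C\<^sub>n\<close> is the whole type \<open>'c\<close>, a vector space over \<open>'k\<close> with scalar
  multiplication \<open>scl\<close>. The direct sums are internal: \<open>summand p n\<close> is \<open>C\<^sup>p\<^sub>n\<close>, so all inclusions are
  identities. The fields \<open>fH\<close>, \<open>fB\<close>, \<open>fK\<close> are the families of the candidate separating bases.
\<close>

record ('k, 'c, 'p) based_complex =
  scl :: "'k \<Rightarrow> 'c \<Rightarrow> 'c"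
  summand :: "'p \<Rightarrow> int \<Rightarrow> 'c set"
  diff :: "'c \<Rightarrow> 'c"
  bas :: "'p \<Rightarrow> int \<Rightarrow> 'c set"
  bas_ord :: "'p \<Rightarrow> int \<Rightarrow> ('c \<times> 'c) set"
  fH :: "'p \<Rightarrow> int \<Rightarrow> 'c set"
  fB :: "'p \<Rightarrow> int \<Rightarrow> 'c set"
  fK :: "'p \<Rightarrow> int \<Rightarrow> 'c set"

type_synonym ('c, 'p) hfamily = "'p \<Rightarrow> int \<Rightarrow> 'c set"


definition is_decomp ::
  "('k::field, 'c::ab_group_add, 'p::order) based_complex \<Rightarrow> 'c \<Rightarrow> ('p \<Rightarrow> int \<Rightarrow> 'c) \<Rightarrow> bool" where
  "is_decomp X v f \<longleftrightarrow>
     (\<forall>p n. f p n \<in> summand X p n) \<and>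
     finite {(p, n). f p n \<noteq> 0} \<and>
     v = (\<Sum>(p, n) \<in> {(p, n). f p n \<noteq> 0}. f p n)"

definition component :: "('k::field, 'c::ab_group_add, 'p::order) based_complex \<Rightarrow> 'c \<Rightarrow> 'p \<Rightarrow> int \<Rightarrow> 'c" where
  "component X v = (THE f. is_decomp X v f)"

text \<open>The subspaces \<open>C\<^sub>n\<close> and \<open>C\<^sup>p\<close>, and the projection \<open>\<jmath>\<^sup>p : C \<rightarrow> C\<^sup>p\<close>.\<close>

definition deg_part :: "('k::field, 'c::ab_group_add, 'p::order) based_complex \<Rightarrow> int \<Rightarrow> 'c set" where
  "deg_part X n = module.span (scl X) (\<Union>p. summand X p n)"

definition grade_part :: "('k::field, 'c::ab_group_add, 'p::order) based_complex \<Rightarrow> 'p \<Rightarrow> 'c set" where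
  "grade_part X p = module.span (scl X) (\<Union>n. summand X p n)"

definition proj :: "('k::field, 'c::ab_group_add, 'p::order) based_complex \<Rightarrow> 'p \<Rightarrow> 'c \<Rightarrow> 'c" where
  "proj X p v = (\<Sum>n \<in> {n. component X v p n \<noteq> 0}. component X v p n)"

text \<open>\<open>t\<^sup>p\<^sup>q = \<jmath>\<^sup>p d \<imath>\<^sup>q\<close>; meaningful on \<open>C\<^sup>q\<close> only.\<close>

definition tpart ::
  "('k::field, 'c::ab_group_add, 'p::order) based_complex \<Rightarrow> 'p \<Rightarrow> 'p \<Rightarrow> 'c \<Rightarrow> 'c" where
  "tpart X p q x = proj X p (diff X x)"

definition graded_complex :: "('k::field, 'c::ab_group_add, 'p::order) based_complex \<Rightarrow> bool" where
  "graded_complex X \<longleftrightarrow>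
     (\<exists>Basis. finite_dimensional_vector_space (scl X) Basis) \<and>
     (\<forall>p n. module.subspace (scl X) (summand X p n)) \<and>
     (\<forall>v. \<exists>!f. is_decomp X v f) \<and>
     Vector_Spaces.linear (scl X) (scl X) (diff X) \<and>
     (\<forall>n. diff X ` deg_part X n \<subseteq> deg_part X (n - 1)) \<and>
     (\<forall>x. diff X (diff X x) = 0) \<and>
     (\<forall>p q. (\<exists>x \<in> grade_part X q. tpart X p q x \<noteq> 0) \<longrightarrow> p \<le> q)"


definition basis_of :: "('k::field \<Rightarrow> 'c::ab_group_add \<Rightarrow> 'c) \<Rightarrow> 'c set \<Rightarrow> 'c set \<Rightarrow> bool" where
  "basis_of s V U \<longleftrightarrow> \<not> module.dependent s U \<and> module.span s U = V"

definition ordered_bases :: "('k::field, 'c::ab_group_add, 'p::order) based_complex \<Rightarrow> bool" where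
  "ordered_bases X \<longleftrightarrow>
     (\<forall>p n. basis_of (scl X) (summand X p n) (bas X p n) \<and>
            linear_order_on (bas X p n) (bas_ord X p n))"

text \<open>\<open>pivot s U r v\<close> is the \<open>r\<close>-largest element of the basis \<open>U\<close> occurring in \<open>v\<close>; it is
  meaningful for nonzero \<open>v\<close> whose support is totally ordered by \<open>r\<close>.\<close>

definition pivot :: "('k::field \<Rightarrow> 'c::ab_group_add \<Rightarrow> 'c) \<Rightarrow> 'c set \<Rightarrow> ('c \<times> 'c) set \<Rightarrow> 'c \<Rightarrow> 'c" where
  "pivot s U r v =
     (THE u. u \<in> U \<and> module.representation s U v u \<noteq> 0 \<and>
        (\<forall>u' \<in> U. module.representation s U v u' \<noteq> 0 \<longrightarrow> (u', u) \<in> r))"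

abbreviation pivot_at ::
  "('k::field, 'c::ab_group_add, 'p::order) based_complex \<Rightarrow> 'p \<Rightarrow> int \<Rightarrow> 'c \<Rightarrow> 'c" where
  "pivot_at X p n \<equiv> pivot (scl X) (bas X p n) (bas_ord X p n)"

text \<open>The basis \<open>\<AA>\<close> of \<open>C\<close>, and the pivot in \<open>\<AA>\<close> with respect to the disjoint union of the orders.
  On a nonzero vector of \<open>C\<^sup>p\<^sub>n\<close> it is the pivot in \<open>\<AA>\<^sup>p\<^sub>n\<close>.\<close>

definition allA :: "('k::field, 'c::ab_group_add, 'p::order) based_complex \<Rightarrow> 'c set" where
  "allA X = (\<Union>p n. bas X p n)"

definition rho :: "('k::field, 'c::ab_group_add, 'p::order) based_complex \<Rightarrow> 'c \<Rightarrow> 'c" where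
  "rho X = pivot (scl X) (allA X) (\<Union>p n. bas_ord X p n)"

text \<open>The coordinate of a chain at a basis element of \<open>\<AA>\<close>, and the coordinate projection
  \<open>\<jmath>\<^sub>a : C \<rightarrow> \<langle>a\<rangle>\<close>.\<close>

definition coord :: "('k::field, 'c::ab_group_add, 'p::order) based_complex \<Rightarrow> 'c \<Rightarrow> 'c \<Rightarrow> 'k" where
  "coord X a v = module.representation (scl X) (allA X) v a"

definition coord_proj :: "('k::field, 'c::ab_group_add, 'p::order) based_complex \<Rightarrow> 'c \<Rightarrow> 'c \<Rightarrow> 'c" where
  "coord_proj X a v = scl X (coord X a v) a"


definition cycles :: "('k::field, 'c::ab_group_add, 'p::order) based_complex \<Rightarrow> 'p \<Rightarrow> int \<Rightarrow> 'c set" where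
  "cycles X p n = {x \<in> summand X p n. tpart X p p x = 0}"

definition bnds :: "('k::field, 'c::ab_group_add, 'p::order) based_complex \<Rightarrow> 'p \<Rightarrow> int \<Rightarrow> 'c set" where
  "bnds X p n = tpart X p p ` summand X p (n + 1)"

text \<open>The last three conjuncts are conditions (S1)--(S3). In (S1) and (S2) the vanishing for \<open>\<HH>\<close> does
  not depend on \<open>\<KK>\<close> being nonempty, and vice versa.\<close>

definition separating_basis :: "('k::field, 'c::ab_group_add, 'p::order) based_complex \<Rightarrow> 'p \<Rightarrow> bool" where
  "separating_basis X p \<longleftrightarrow> (\<forall>n.
     let c = module.representation (scl X) (bas X p n); \<rho> = pivot_at X p n;
         \<HH> = fH X p n; \<BB> = fB X p n; \<KK> = fK X p n in
     \<HH> \<inter> \<BB> = {} \<and> \<HH> \<inter> \<KK> = {} \<and> \<BB> \<inter> \<KK> = {} \<and>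
     basis_of (scl X) (summand X p n) (\<HH> \<union> \<BB> \<union> \<KK>) \<and>
     inj_on \<rho> (\<HH> \<union> \<BB> \<union> \<KK>) \<and>
     basis_of (scl X) (bnds X p n) \<BB> \<and>
     basis_of (scl X) (cycles X p n) (\<HH> \<union> \<BB>) \<and>
     bij_betw (tpart X p p) \<KK> (fB X p (n - 1)) \<and>
     (\<forall>b \<in> \<rho> ` \<BB>. (\<forall>z \<in> \<HH>. c z b = 0) \<and> (\<forall>w \<in> \<KK>. c w b = 0)) \<and>
     (\<forall>z \<in> \<HH>. (\<forall>v \<in> \<HH> - {z}. c v (\<rho> z) = 0) \<and> (\<forall>w \<in> \<KK>. c w (\<rho> z) = 0)) \<and>
     (\<forall>z \<in> \<HH>. c z (\<rho> z) = 1))"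

definition allH :: "('k::field, 'c::ab_group_add, 'p::order) based_complex \<Rightarrow> 'c set" where
  "allH X = (\<Union>p n. fH X p n)"


text \<open>
  Elements of \<open>H\<^sup>p\<^sub>n = ker t\<^sup>p\<^sub>n / B\<^sup>p\<^sub>n\<close> are cosets of \<open>B\<^sup>p\<^sub>n\<close>, with zero \<open>B\<^sup>p\<^sub>n\<close>. In \<open>hscale\<close> adding \<open>B\<^sup>p\<^sub>n\<close>
  matters only for the scalar \<open>0\<close>, in \<open>hsum\<close> only for the empty sum; the sum of two cosets is
  their elementwise sum.
\<close>

definition hclass :: "('k::field, 'c::ab_group_add, 'p::order) based_complex \<Rightarrow> 'p \<Rightarrow> int \<Rightarrow> 'c \<Rightarrow> 'c set" where
  "hclass X p n x = x +o bnds X p n"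

definition homology :: "('k::field, 'c::ab_group_add, 'p::order) based_complex \<Rightarrow> 'p \<Rightarrow> int \<Rightarrow> 'c set set" where
  "homology X p n = hclass X p n ` cycles X p n"

definition hscale ::
  "('k::field, 'c::ab_group_add, 'p::order) based_complex \<Rightarrow> 'p \<Rightarrow> int \<Rightarrow> 'k \<Rightarrow> 'c set \<Rightarrow> 'c set" where
  "hscale X p n a Y = bnds X p n + scl X a ` Y"

definition hsum ::
  "('k::field, 'c::ab_group_add, 'p::order) based_complex \<Rightarrow> 'p \<Rightarrow> int \<Rightarrow> ('i \<Rightarrow> 'c set) \<Rightarrow> 'i set \<Rightarrow> 'c set" where
  "hsum X p n f I = bnds X p n + (\<Sum>i\<in>I. f i)"

text \<open>\<open>\<Oplus>\<^bsub>p,n\<^esub> H\<^sup>p\<^sub>n\<close>, with componentwise operations.\<close>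

definition conley_space :: "('k::field, 'c::ab_group_add, 'p::order) based_complex \<Rightarrow> ('c, 'p) hfamily set" where
  "conley_space X = {h. (\<forall>p n. h p n \<in> homology X p n) \<and> finite {(p, n). h p n \<noteq> bnds X p n}}"

definition bar_scale ::
  "('k::field, 'c::ab_group_add, 'p::order) based_complex \<Rightarrow> 'k \<Rightarrow> ('c, 'p) hfamily \<Rightarrow> ('c, 'p) hfamily" where
  "bar_scale X a h = (\<lambda>p n. hscale X p n a (h p n))"

definition bar_sum ::
  "('k::field, 'c::ab_group_add, 'p::order) based_complex \<Rightarrow> ('i \<Rightarrow> ('c, 'p) hfamily) \<Rightarrow> 'i set \<Rightarrow> ('c, 'p) hfamily" where
  "bar_sum X f I = (\<lambda>p n. hsum X p n (\<lambda>i. f i p n) I)"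


text \<open>\<open>\<zeta>\<^sup>p\<^sub>n : C\<^sup>p\<^sub>n \<rightarrow> H\<^sup>p\<^sub>n \<oplus> B\<^sup>p\<^sub>n \<oplus> K\<^sup>p\<^sub>n\<close> with \<open>K\<^sup>p\<^sub>n = B\<^bsup>p\<^esup>\<^bsub>n-1\<^esub>\<close>: the linear extension of
  \<open>z \<mapsto> [z]\<close>, \<open>b \<mapsto> b\<close>, \<open>w \<mapsto> t w\<close>.\<close>

definition zeta_at ::
  "('k::field, 'c::ab_group_add, 'p::order) based_complex \<Rightarrow> 'p \<Rightarrow> int \<Rightarrow> 'c \<Rightarrow> 'c set \<times> 'c \<times> 'c" where
  "zeta_at X p n x =
     (let c = module.representation (scl X) (fH X p n \<union> fB X p n \<union> fK X p n) x in
      (hsum X p n (\<lambda>z. hscale X p n (c z) (hclass X p n z)) (fH X p n),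
       \<Sum>b\<in>fB X p n. scl X (c b) b,
       \<Sum>w\<in>fK X p n. scl X (c w) (tpart X p p w)))"

definition zeta ::
  "('k::field, 'c::ab_group_add, 'p::order) based_complex \<Rightarrow> 'c \<Rightarrow> 'p \<Rightarrow> int \<Rightarrow> 'c set \<times> 'c \<times> 'c" where
  "zeta X x = (\<lambda>p n. zeta_at X p n (component X x p n))"

definition alpha :: "('k::field, 'c::ab_group_add, 'p::order) based_complex \<Rightarrow> 'c \<Rightarrow> ('c, 'p) hfamily" where
  "alpha X x = (\<lambda>p n. fst (zeta X x p n))"

definition bar_incl :: "('c::ab_group_add, 'p) hfamily \<Rightarrow> 'p \<Rightarrow> int \<Rightarrow> 'c set \<times> 'c \<times> 'c" where
  "bar_incl h = (\<lambda>p n. (h p n, 0, 0))"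

definition beta :: "('k::field, 'c::ab_group_add, 'p::order) based_complex \<Rightarrow> ('c, 'p) hfamily \<Rightarrow> 'c" where
  "beta X h = inv (zeta X) (bar_incl h)"

text \<open>The element \<open>\<zeta>(z)\<close> of \<open>\<Oplus>\<^bsub>p,n\<^esub> H\<^sup>p\<^sub>n\<close>, for \<open>z\<close> in one of the \<open>\<HH>\<^sup>p\<^sub>n\<close>: the other components of
  \<open>\<zeta>(z)\<close> vanish, so \<open>\<zeta>(z)\<close> is the inclusion of a unique such family.\<close>

definition zeta_bar :: "('k::field, 'c::ab_group_add, 'p::order) based_complex \<Rightarrow> 'c \<Rightarrow> ('c, 'p) hfamily" where
  "zeta_bar X z = (THE h. h \<in> conley_space X \<and> bar_incl h = zeta X z)"

text \<open>The component of \<open>\<gamma>\<close> at \<open>(p, n)\<close> sends an element of \<open>B\<^sup>p\<^sub>n = K\<^bsup>p\<^esup>\<^bsub>n+1\<^esub>\<close> back along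
  \<open>\<zeta>\<^bsup>p\<^esup>\<^bsub>n+1\<^esub>\<close>.\<close>

definition gamma_at ::
  "('k::field, 'c::ab_group_add, 'p::order) based_complex \<Rightarrow> 'p \<Rightarrow> int \<Rightarrow> 'c \<Rightarrow> 'c" where
  "gamma_at X p n x =
     - inv_into (summand X p (n + 1)) (zeta_at X p (n + 1))
         (bnds X p (n + 1), 0, fst (snd (zeta_at X p n x)))"

definition gamma :: "('k::field, 'c::ab_group_add, 'p::order) based_complex \<Rightarrow> 'c \<Rightarrow> 'c" where
  "gamma X x = (\<Sum>(p, n) \<in> {(p, n). component X x p n \<noteq> 0}. gamma_at X p n (component X x p n))"

text \<open>\<open>\<theta>\<close> is the linear map with \<open>\<theta>(\<rho>(z)) = \<zeta>(z)\<close>; meaningful on the span of \<open>\<rho>(\<HH>)\<close> only.\<close>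

definition theta :: "('k::field, 'c::ab_group_add, 'p::order) based_complex \<Rightarrow> 'c \<Rightarrow> ('c, 'p) hfamily" where
  "theta X v =
     bar_sum X (\<lambda>z. bar_scale X (module.representation (scl X) (rho X ` allH X) v (rho X z)) (zeta_bar X z))
       (allH X)"


definition dhat :: "('k::field, 'c::ab_group_add, 'p::order) based_complex \<Rightarrow> 'c \<Rightarrow> 'c" where
  "dhat X x = (\<Sum>p \<in> {p. proj X p x \<noteq> 0}. tpart X p p (proj X p x))"

definition delta :: "('k::field, 'c::ab_group_add, 'p::order) based_complex \<Rightarrow> 'c \<Rightarrow> 'c" where
  "delta X x = diff X x - dhat X x"

text \<open>\<open>\<S> = \<delta>(1 - \<gamma>\<delta>)\<^sup>-\<^sup>1\<close>; \<open>inv\<close> is the functional inverse, as \<open>\<gamma>\<delta>\<close> is nilpotent.\<close>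

definition Sop :: "('k::field, 'c::ab_group_add, 'p::order) based_complex \<Rightarrow> 'c \<Rightarrow> 'c" where
  "Sop X = delta X \<circ> inv (\<lambda>x. x - gamma X (delta X x))"

definition dbar :: "('k::field, 'c::ab_group_add, 'p::order) based_complex \<Rightarrow> ('c, 'p) hfamily \<Rightarrow> ('c, 'p) hfamily" where
  "dbar X = alpha X \<circ> Sop X \<circ> beta X"

text \<open>Coordinates in the basis \<open>\<zeta>(\<HH>)\<close>, indexed by \<open>\<HH>\<close> itself.\<close>

definition bar_coords ::
  "('k::field, 'c::ab_group_add, 'p::order) based_complex \<Rightarrow> ('c, 'p) hfamily \<Rightarrow> 'c \<Rightarrow> 'k" where
  "bar_coords X h =
     (THE c. (\<forall>z. z \<notin> allH X \<longrightarrow> c z = 0) \<and>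
        h = bar_sum X (\<lambda>z. bar_scale X (c z) (zeta_bar X z)) (allH X))"

text \<open>Row \<open>\<zeta>(z)\<close>, column \<open>\<zeta>(z')\<close>.\<close>

definition connection_matrix ::
  "('k::field, 'c::ab_group_add, 'p::order) based_complex \<Rightarrow> 'c \<Rightarrow> 'c \<Rightarrow> 'k" where
  "connection_matrix X z z' = bar_coords X (dbar X (zeta_bar X z')) z"

end

theory Submission
  imports Defs
begin

text \<open>
  Put \<open>x = (1 + \<gamma>\<S>) z\<^sub>j\<close>, which equals \<open>(1 - \<gamma>\<delta>)\<^bsup>-1\<^esup> z\<^sub>j\<close>, so that \<open>\<S> z\<^sub>j = \<delta> x\<close>
  (lemma \<open>Sop_eq_delta\<close>). The inverse exists because \<open>\<gamma>\<close> preserves the grade while \<open>\<delta>\<close> strictly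
  lowers it (\<open>surj_id_minus_gamma_delta\<close>). Writing \<open>d = \<delta> + dhat\<close> and using that \<open>z\<^sub>j\<close> is a cycle of its
  relative complex,
  \<open>d x = \<S> z\<^sub>j + dhat (\<gamma> (\<S> z\<^sub>j))\<close>.

  The homotopy \<open>\<gamma>\<close> lifts the boundary part of a chain along \<open>t\<^sup>p : \<langle>\<KK>\<rangle> \<rightarrow> \<langle>\<BB>\<rangle>\<close>, with
  a sign, so \<open>dhat \<circ> \<gamma>\<close> is minus the projection onto \<open>\<langle>\<BB>\<rangle>\<close> (\<open>component_dhat_gamma\<close>).
  Therefore \<open>d x\<close> is \<open>\<S> z\<^sub>j\<close> with its \<open>\<BB>\<close>-part deleted: a combination of \<open>\<HH>\<close> and
  \<open>\<KK>\<close> with the same \<open>\<HH>\<close>-coefficients as \<open>\<S> z\<^sub>j\<close> (\<open>component_diff_perturbed\<close>).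

  The entry of the connection matrix is the coefficient of \<open>z\<^sub>i\<close> in \<open>\<S> z\<^sub>j\<close>, because \<open>\<alpha>\<close> reads
  off the \<open>\<HH>\<close>-coefficients (\<open>bar_coords_alpha\<close>). By the separating conditions, \<open>z\<^sub>i\<close> is the
  only vector of \<open>\<HH> \<union> \<KK>\<close> with a nonzero coordinate at \<open>\<rho>(z\<^sub>i)\<close>, and that coordinate
  is \<open>1\<close>. So the coordinate of \<open>d x\<close> at \<open>\<rho>(z\<^sub>i)\<close> is the same coefficient
  (\<open>coord_pivot\<close>).
\<close>

section \<open>Linear endomaps of a vector space\<close>

lemma linearI_field:
  assumes "vector_space s"
    and "\<And>x y. f (x + y) = f x + f y" and "\<And>a x. f (s a x) = s a (f x)"
  shows "Vector_Spaces.linear s s f"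
  using assms by (simp add: linear_iff)

lemma linear_addD: "Vector_Spaces.linear s s f \<Longrightarrow> f (x + y) = f x + f y"
  and linear_scaleD: "Vector_Spaces.linear s s f \<Longrightarrow> f (s a x) = s a (f x)"
  by (simp_all add: linear_iff)

lemma linear_zeroD: "Vector_Spaces.linear s s f \<Longrightarrow> f 0 = 0"
  by (metis add_cancel_right_right linear_addD)

lemma linear_sumD:
  assumes "Vector_Spaces.linear s s f"
  shows "f (\<Sum>i\<in>I. g i) = (\<Sum>i\<in>I. f (g i))"
  by (induction I rule: infinite_finite_induct)
     (simp_all add: linear_zeroD[OF assms] linear_addD[OF assms])

lemma linear_diffD:
  assumes "Vector_Spaces.linear s s f"
  shows "f (x - y) = f x - f y"
  by (metis add_diff_cancel_right' assms diff_add_cancel linear_addD)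

lemma linear_negD:
  assumes "Vector_Spaces.linear s s f"
  shows "f (- x) = - f x"
  using linear_diffD[OF assms, of 0 x] by (simp add: linear_zeroD[OF assms])

section \<open>Arithmetic of cosets\<close>

text \<open>
  Homology classes are cosets of the boundaries, and the operations on them are elementwise set
  operations. The rules below reduce every such operation to vector arithmetic on representatives.
\<close>

context vector_space
begin

lemma coset_eq_iff:
  assumes "subspace N"
  shows "x +o N = y +o N \<longleftrightarrow> x - y \<in> N"
proof
  assume "x +o N = y +o N"
  then have "x \<in> y +o N"
    using subspace_0[OF assms] by (metis add.right_neutral set_plus_intro2)
  then show "x - y \<in> N" by (rule set_plus_imp_minus)
next
  assume xy: "x - y \<in> N"
  have "u \<in> x +o N \<longleftrightarrow> u \<in> y +o N" for u
  proof -
    have "u \<in> v +o N \<longleftrightarrow> u - v \<in> N" for v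
      by (simp add: set_minus_plus)
    moreover have "u - y = (u - x) + (x - y)" "u - x = (u - y) - (x - y)" by auto
    ultimately show ?thesis
      using xy assms by (metis subspace_add subspace_diff)
  qed
  then show "x +o N = y +o N" by blast
qed

lemma coset_eq_self_iff:
  assumes "subspace N"
  shows "x +o N = N \<longleftrightarrow> x \<in> N"
proof -
  have "0 +o N = N" by (simp add: elt_set_plus_def)
  then show ?thesis using coset_eq_iff[OF assms, of x 0] by simp
qed

lemma subspace_plus_coset:
  assumes "subspace N"
  shows "N + (x +o N) = x +o N"
proof -
  have "N + N = N"
    using assms by (auto simp: set_plus_def subspace_add subspace_0) (metis add.left_neutral subspace_0)
  then show ?thesis by (metis add.commute set_plus_rearrange3)
qed

lemma coset_scale:
  assumes "subspace N"
  shows "N + scale a ` (x +o N) = scale a x +o N"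
proof
  show "N + scale a ` (x +o N) \<subseteq> scale a x +o N"
    using assms
    by (auto simp: set_plus_def elt_set_plus_def scale_right_distrib)
       (metis add.commute add.left_commute subspace_add subspace_scale)
  show "scale a x +o N \<subseteq> N + scale a ` (x +o N)"
  proof
    fix u assume "u \<in> scale a x +o N"
    then obtain m where m: "m \<in> N" "u = scale a x + m" by (auto simp: elt_set_plus_def)
    have "x \<in> x +o N" using subspace_0[OF assms] by (metis add.right_neutral set_plus_intro2)
    then show "u \<in> N + scale a ` (x +o N)"
      using m by (auto simp: add.commute[of "scale a x"])
  qed
qed

lemma coset_sum:
  assumes "subspace N" "finite I"
  shows "N + (\<Sum>i\<in>I. f i +o N) = (\<Sum>i\<in>I. f i) +o N"
  using assms(2)
proof (induction I)
  case empty
  have "N + 0 = N" by simp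
  moreover have "0 +o N = N" by (simp add: elt_set_plus_def)
  ultimately show ?case by simp
next
  case (insert j J)
  have "N + (\<Sum>i\<in>insert j J. f i +o N) = (f j +o N) + (N + (\<Sum>i\<in>J. f i +o N))"
    using insert(1,2) by (simp add: add.left_commute)
  also have "\<dots> = (f j +o N) + ((\<Sum>i\<in>J. f i) +o N)" using insert by simp
  also have "\<dots> = (f j + (\<Sum>i\<in>J. f i)) +o (N + N)" by (simp add: set_plus_rearrange)
  also have "N + N = N" using subspace_plus_coset[OF assms(1), of 0] by (simp add: elt_set_plus_def)
  finally show ?case using insert by simp
qed

end

section \<open>Components in a graded complex\<close>

locale graded =
  fixes X :: "('k::field, 'c::ab_group_add, 'p::order) based_complex"
  assumes graded: "graded_complex X"
begin

lemma vector_space_scl: "vector_space (scl X)"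
  using graded unfolding graded_complex_def finite_dimensional_vector_space_def by blast

sublocale vector_space "scl X" by (rule vector_space_scl)

abbreviation lin :: "('c \<Rightarrow> 'c) \<Rightarrow> bool" where
  "lin \<equiv> Vector_Spaces.linear (scl X) (scl X)"

lemma finite_dimensional: "\<exists>Basis. finite_dimensional_vector_space (scl X) Basis"
  using graded unfolding graded_complex_def by (rule conjunct1)

lemma finite_independent:
  assumes "independent B" shows "finite B"
  using finite_dimensional
  by (rule exE) (rule finite_dimensional_vector_space.finiteI_independent[OF _ assms])

lemma injective_linear_surj:
  assumes "lin f" "inj f" shows "surj f"
  using finite_dimensional
  by (rule exE) (rule finite_dimensional_vector_space.linear_inj_imp_surj[OF _ assms])

lemma subspace_summand: "subspace (summand X p n)"
  using graded unfolding graded_complex_def by blast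

lemma ex1_decomp: "\<exists>!f. is_decomp X v f"
  using graded unfolding graded_complex_def by (elim conjE) (erule spec)

lemma component_decomp: "is_decomp X v (component X v)"
  unfolding component_def using theI'[OF ex1_decomp] .

lemma component_eqI: "is_decomp X v f \<Longrightarrow> component X v = f"
  by (rule ex1E[OF ex1_decomp[of v]]) (metis component_decomp)

lemma component_in [simp]: "component X v p n \<in> summand X p n"
  using component_decomp unfolding is_decomp_def by blast

lemma decomp_superset:
  assumes "finite S" "{(p, n). f p n \<noteq> 0} \<subseteq> S" "\<And>p n. f p n \<in> summand X p n"
    "v = (\<Sum>(p, n)\<in>S. f p n)"
  shows "component X v = f"
proof (rule component_eqI)
  have "(\<Sum>(p, n)\<in>S. f p n) = (\<Sum>(p, n)\<in>{(p, n). f p n \<noteq> 0}. f p n)"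
    using assms(1,2) by (intro sum.mono_neutral_right) auto
  then show "is_decomp X v f"
    unfolding is_decomp_def using assms finite_subset by auto
qed

lemma sum_component_superset:
  assumes "finite S" "{(p, n). component X v p n \<noteq> 0} \<subseteq> S"
  shows "(\<Sum>(p, n)\<in>S. component X v p n) = v"
proof -
  have "(\<Sum>(p, n)\<in>S. component X v p n)
      = (\<Sum>(p, n)\<in>{(p, n). component X v p n \<noteq> 0}. component X v p n)"
    using assms by (intro sum.mono_neutral_right) auto
  also have "\<dots> = v" using component_decomp unfolding is_decomp_def by metis
  finally show ?thesis .
qed

lemma finite_support: "finite {(p, n). component X v p n \<noteq> 0}"
  using component_decomp unfolding is_decomp_def by blast

lemma component_summand:
  assumes "x \<in> summand X p n"
  shows "component X x q m = (if q = p \<and> m = n then x else 0)"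
proof -
  have "component X x = (\<lambda>q m. if q = p \<and> m = n then x else 0)"
    by (rule decomp_superset[of "{(p, n)}"]) (use assms subspace_0[OF subspace_summand] in auto)
  then show ?thesis by simp
qed

lemma linear_component: "lin (\<lambda>v. component X v p n)"
proof (rule linearI_field[OF vector_space_scl])
  fix x y
  let ?S = "{(p, n). component X x p n \<noteq> 0} \<union> {(p, n). component X y p n \<noteq> 0}"
  have fin: "finite ?S" using finite_support by blast
  have "component X (x + y) = (\<lambda>p n. component X x p n + component X y p n)"
  proof (rule decomp_superset[OF fin])
    have "(\<Sum>(p, n)\<in>?S. component X x p n) = x" "(\<Sum>(p, n)\<in>?S. component X y p n) = y"
      by (rule sum_component_superset[OF fin]; blast)+
    then show "x + y = (\<Sum>(p, n)\<in>?S. component X x p n + component X y p n)"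
      by (simp add: sum.distrib case_prod_unfold)
  qed (auto intro: subspace_add[OF subspace_summand])
  then show "component X (x + y) p n = component X x p n + component X y p n" by simp
next
  fix a x
  let ?S = "{(p, n). component X x p n \<noteq> 0}"
  have "component X (scl X a x) = (\<lambda>p n. scl X a (component X x p n))"
  proof (rule decomp_superset[OF finite_support[of x]])
    have "(\<Sum>(p, n)\<in>?S. component X x p n) = x"
      by (rule sum_component_superset[OF finite_support]) blast
    then show "scl X a x = (\<Sum>(p, n)\<in>?S. scl X a (component X x p n))"
      by (metis (mono_tags, lifting) case_prod_unfold scale_sum_right sum.cong)
  qed (auto intro: subspace_scale[OF subspace_summand])
  then show "component X (scl X a x) p n = scl X a (component X x p n)" by simp
qed

lemma vector_eqI:
  assumes "\<And>p n. component X x p n = component X y p n"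
  shows "x = y"
proof -
  have "component X x = component X y" using assms by blast
  then show ?thesis
    using sum_component_superset[OF finite_support[of x], of x]
      sum_component_superset[OF finite_support[of x], of y] by simp
qed

text \<open>
  Taking the component at \<open>(p, n)\<close> of a vanishing linear combination leaves exactly the terms
  that come from \<open>U p n\<close>, so the independence of each \<open>U p n\<close> suffices.
\<close>

lemma independent_Union_summands:
  assumes "\<And>p n. independent (U p n)" "\<And>p n. U p n \<subseteq> summand X p n"
  shows "independent (\<Union>p n. U p n)"
  unfolding independent_explicit_module
proof (intro allI impI)
  fix T c v
  assume T: "finite T" "T \<subseteq> (\<Union>p n. U p n)" "(\<Sum>v\<in>T. scl X (c v) v) = 0" "v \<in> T"
  then obtain p n where v: "v \<in> U p n" by blast
  have mem: "a \<in> U p n \<longleftrightarrow> component X a p n \<noteq> 0" "component X a p n = (if a \<in> U p n then a else 0)"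
    if aT: "a \<in> T" for a
  proof -
    obtain q m where a: "a \<in> U q m" using aT T by blast
    then have "a \<noteq> 0" using assms(1) dependent_zero by blast
    moreover have "component X a q' m' = (if q' = q \<and> m' = m then a else 0)" for q' m'
      using component_summand a assms(2) by blast
    moreover have "component X a p n = a" if "a \<in> U p n"
      using component_summand[of a p n p n] that assms(2)[of p n] by auto
    ultimately show "a \<in> U p n \<longleftrightarrow> component X a p n \<noteq> 0"
      "component X a p n = (if a \<in> U p n then a else 0)"
      using a by (metis (full_types))+
  qed
  have "0 = component X (\<Sum>v\<in>T. scl X (c v) v) p n"
    using T(3) linear_zeroD[OF linear_component] by simp
  also have "\<dots> = (\<Sum>a\<in>T. scl X (c a) (component X a p n))"
    by (simp add: linear_sumD[OF linear_component] linear_scaleD[OF linear_component])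
  also have "\<dots> = (\<Sum>a\<in>T. if a \<in> U p n then scl X (c a) a else 0)"
    by (rule sum.cong) (use mem(2) in auto)
  also have "\<dots> = (\<Sum>a\<in>T \<inter> U p n. scl X (c a) a)"
    using T(1) by (simp add: sum.inter_restrict)
  finally show "c v = 0"
    using independentD[OF assms(1)[of p n], of "T \<inter> U p n" c v] T v by auto
qed

lemma summands_disjoint:
  assumes "x \<in> summand X p n" "x \<in> summand X q m" "x \<noteq> 0"
  shows "q = p" "m = n"
  using component_summand[OF assms(1), of q m] component_summand[OF assms(2), of q m] assms(3)
  by (auto split: if_splits)

text \<open>
  The indices of the nonzero summands. Finite dimension makes this set finite
  (\<open>finite_supp\<close>), so all direct sums below can be taken over it.
\<close>

definition supp :: "('p \<times> int) set" where
  "supp = {(p, n). summand X p n \<noteq> {0}}"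

text \<open>
  A nonzero vector chosen in each nonzero summand gives an independent set, which is finite.
\<close>

lemma finite_supp: "finite supp"
proof -
  define f where "f = (\<lambda>(p, n). SOME x. x \<in> summand X p n \<and> x \<noteq> 0)"
  have f: "f (p, n) \<in> summand X p n" "f (p, n) \<noteq> 0" if "(p, n) \<in> supp" for p n
  proof -
    have "\<exists>x. x \<in> summand X p n \<and> x \<noteq> 0"
      using that subspace_0[OF subspace_summand] unfolding supp_def by blast
    from someI_ex[OF this] show "f (p, n) \<in> summand X p n" "f (p, n) \<noteq> 0"
      unfolding f_def by auto
  qed
  define U where "U = (\<lambda>p n. if (p, n) \<in> supp then {f (p, n)} else {})"
  have "independent (\<Union>p n. U p n)"
    by (rule independent_Union_summands) (use f in \<open>auto simp: U_def independent_empty\<close>)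
  moreover have "(\<Union>p n. U p n) = f ` supp" by (auto simp: U_def)
  ultimately have "finite (f ` supp)" using finite_independent by simp
  moreover have "inj_on f supp"
  proof (rule inj_onI, clarify)
    fix p n q m assume "(p, n) \<in> supp" "(q, m) \<in> supp" "f (p, n) = f (q, m)"
    then show "p = q \<and> n = m" using f summands_disjoint by metis
  qed
  ultimately show ?thesis using finite_imageD by blast
qed

lemma component_outside: "(p, n) \<notin> supp \<Longrightarrow> component X v p n = 0"
  using component_in[of v p n] by (auto simp: supp_def)

lemma sum_component: "(\<Sum>(p, n)\<in>supp. component X v p n) = v"
  by (rule sum_component_superset[OF finite_supp]) (use component_outside in blast)

lemma sum_supp_single:
  fixes g :: "'p \<Rightarrow> int \<Rightarrow> 'a::comm_monoid_add"
  assumes "\<And>q m. \<not> (q = p \<and> m = n) \<Longrightarrow> g q m = 0" "(p, n) \<notin> supp \<Longrightarrow> g p n = 0"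
  shows "(\<Sum>(q, m)\<in>supp. g q m) = g p n"
proof -
  have "(\<Sum>(q, m)\<in>supp. g q m) = (\<Sum>a\<in>supp. if a = (p, n) then g p n else 0)"
  proof (rule sum.cong[OF refl])
    fix a
    show "(case a of (q, m) \<Rightarrow> g q m) = (if a = (p, n) then g p n else 0)"
      by (cases a; cases "a = (p, n)") (use assms(1) in auto)
  qed
  then show ?thesis using finite_supp assms(2) by simp
qed

text \<open>
  Coordinates are local: in a basis assembled from bases of the summands, the coordinate at a vector
  of \<open>U p n\<close> depends on the component at \<open>(p, n)\<close> only. This is used both for the basis
  \<open>\<AA>\<close> and for the union of the separating bases.
\<close>

lemma representation_Union:
  assumes indep: "\<And>p n. independent (U p n)" and span: "\<And>p n. span (U p n) = summand X p n"
    and u: "u \<in> U p n"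
  shows "representation (\<Union>p n. U p n) v u = representation (U p n) (component X v p n) u"
proof -
  let ?U = "\<Union>p n. U p n"
  have sub: "U q m \<subseteq> summand X q m" for q m using span span_superset by metis
  have ind: "independent ?U" by (rule independent_Union_summands[OF indep sub])
  have spanU: "component X v q m \<in> span (U q m)" for q m by (simp add: span)
  have ext: "representation ?U (component X v q m) = representation (U q m) (component X v q m)" for q m
    by (rule representation_extend[OF ind spanU]) blast
  have spanU': "component X v q m \<in> span ?U" for q m
    using spanU span_mono[of "U q m" ?U] by blast
  have u0: "u \<noteq> 0" using u indep dependent_zero by blast
  have other: "representation (U q m) (component X v q m) u = 0" if "\<not> (q = p \<and> m = n)" for q m
    using representation_ne_zero that summands_disjoint[OF _ _ u0] sub u by blast
  have "representation ?U v u = representation ?U (\<Sum>(q, m)\<in>supp. component X v q m) u"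
    by (simp add: sum_component)
  also have "\<dots> = (\<Sum>(q, m)\<in>supp. representation ?U (component X v q m) u)"
    by (subst representation_sum[OF ind]) (use spanU' in \<open>auto simp: case_prod_unfold\<close>)
  also have "\<dots> = representation ?U (component X v p n) u"
    by (rule sum_supp_single) (auto simp: ext other component_outside representation_zero)
  also have "\<dots> = representation (U p n) (component X v p n) u" by (simp add: ext)
  finally show ?thesis .
qed

section \<open>The differential and its diagonal part\<close>

lemma linear_diff: "lin (diff X)"
  using graded unfolding graded_complex_def by (elim conjE)

lemma component_proj: "component X (proj X p v) q m = (if q = p then component X v p m else 0)"
proof -
  let ?N = "{n. component X v p n \<noteq> 0}"
  have "?N \<subseteq> snd ` {(p, n). component X v p n \<noteq> 0}" by force
  then have fin: "finite ?N" using finite_support finite_surj by blast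
  have "component X (proj X p v) q m = (\<Sum>n\<in>?N. component X (component X v p n) q m)"
    unfolding proj_def by (simp add: linear_sumD[OF linear_component])
  also have "\<dots> = (\<Sum>n\<in>?N. if n = m then (if q = p then component X v p m else 0) else 0)"
    by (rule sum.cong) (auto simp: component_summand[OF component_in])
  also have "\<dots> = (if q = p then component X v p m else 0)" using fin by simp
  finally show ?thesis .
qed

lemma linear_proj: "lin (proj X p)"
  by (rule linearI_field[OF vector_space_scl]; rule vector_eqI)
     (simp_all add: component_proj linear_addD[OF linear_component] linear_scaleD[OF linear_component])

lemma proj_summand: "x \<in> summand X p n \<Longrightarrow> proj X q x = (if q = p then x else 0)"
  by (rule vector_eqI)
     (auto simp: component_proj component_summand[of x p n] linear_zeroD[OF linear_component])

lemma linear_tpart: "lin (tpart X p q)"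
  unfolding tpart_def
  by (rule linearI_field[OF vector_space_scl])
     (simp_all add: linear_addD[OF linear_proj] linear_addD[OF linear_diff]
        linear_scaleD[OF linear_proj] linear_scaleD[OF linear_diff])

lemma component_dhat: "component X (dhat X x) p n = component X (diff X (proj X p x)) p n"
proof -
  let ?P = "{p. proj X p x \<noteq> 0}"
  have "?P \<subseteq> fst ` {(p, n). component X x p n \<noteq> 0}"
  proof
    fix p assume "p \<in> ?P"
    then obtain q n where "component X (proj X p x) q n \<noteq> 0"
      using vector_eqI[of "proj X p x" 0] linear_zeroD[OF linear_component] by auto
    then have "(p, n) \<in> {(p, n). component X x p n \<noteq> 0}"
      by (auto simp: component_proj split: if_splits)
    then show "p \<in> fst ` {(p, n). component X x p n \<noteq> 0}" by force
  qed
  then have fin: "finite ?P" using finite_support finite_surj by blast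
  have "component X (dhat X x) p n = (\<Sum>q\<in>?P. component X (tpart X q q (proj X q x)) p n)"
    unfolding dhat_def by (simp add: linear_sumD[OF linear_component])
  also have "\<dots> = (\<Sum>q\<in>?P. if q = p then component X (diff X (proj X p x)) p n else 0)"
    by (rule sum.cong) (auto simp: tpart_def component_proj)
  also have "\<dots> = component X (diff X (proj X p x)) p n"
    using fin by (simp add: linear_zeroD[OF linear_diff] linear_zeroD[OF linear_component])
  finally show ?thesis .
qed

lemma linear_dhat: "lin (dhat X)"
  by (rule linearI_field[OF vector_space_scl]; rule vector_eqI)
     (simp_all add: component_dhat linear_addD[OF linear_component] linear_scaleD[OF linear_component]
       linear_addD[OF linear_proj] linear_addD[OF linear_diff]
        linear_scaleD[OF linear_proj] linear_scaleD[OF linear_diff])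

lemma dhat_summand:
  assumes "x \<in> summand X p n"
  shows "dhat X x = tpart X p p x"
  by (rule vector_eqI)
     (auto simp: component_dhat proj_summand[OF assms] tpart_def component_proj
       linear_zeroD[OF linear_diff] linear_zeroD[OF linear_component])

lemma linear_delta: "lin (delta X)"
  unfolding delta_def
  by (rule linearI_field[OF vector_space_scl])
     (simp_all add: linear_addD[OF linear_dhat] linear_addD[OF linear_diff]
        linear_scaleD[OF linear_dhat] linear_scaleD[OF linear_diff] scale_right_diff_distrib)

text \<open>
  Subtracting the diagonal part \<open>dhat\<close> from \<open>d\<close> removes precisely the terms that preserve the
  grade; the remaining \<open>t\<^sup>p\<^sup>q\<close> vanish unless \<open>p < q\<close>.
\<close>

lemma delta_triangular:
  assumes "component X (delta X x) p n \<noteq> 0"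
  shows "\<exists>q m. p < q \<and> component X x q m \<noteq> 0"
proof -
  \<comment> \<open>Subtracting \<open>dhat\<close> at grade \<open>p\<close> amounts to applying \<open>d\<close> to the part of \<open>x\<close> outside grade \<open>p\<close>.\<close>
  define y where "y = x - proj X p x"
  have y: "component X y q m = (if q = p then 0 else component X x q m)" for q m
    by (simp add: y_def linear_diffD[OF linear_component] component_proj)
  have "component X (delta X x) p n = component X (diff X y) p n"
    by (simp add: delta_def y_def linear_diffD[OF linear_component] linear_diffD[OF linear_diff]
        component_dhat)
  also have "\<dots> = component X (diff X (\<Sum>(q, m)\<in>supp. component X y q m)) p n"
    by (simp add: sum_component)
  also have "\<dots> = (\<Sum>(q, m)\<in>supp. component X (diff X (component X y q m)) p n)"
    by (simp add: linear_sumD[OF linear_component] linear_sumD[OF linear_diff] case_prod_unfold)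
  finally have "(\<Sum>(q, m)\<in>supp. component X (diff X (component X y q m)) p n) \<noteq> 0"
    using assms by simp
  then obtain q m where nz: "component X (diff X (component X y q m)) p n \<noteq> 0"
    by (smt (verit, ccfv_SIG) case_prod_unfold sum.neutral)
  then have "component X y q m \<noteq> 0"
    using linear_zeroD[OF linear_diff] linear_zeroD[OF linear_component] by metis
  then have q: "q \<noteq> p" "component X x q m \<noteq> 0" using y[of q m] by (auto split: if_splits)
  have "component X (tpart X p q (component X y q m)) p n \<noteq> 0"
    using nz by (simp add: tpart_def component_proj)
  then have "tpart X p q (component X y q m) \<noteq> 0"
    using linear_zeroD[OF linear_component] by metis
  moreover have "component X y q m \<in> grade_part X q"
    unfolding grade_part_def by (intro span_base) (use component_in in blast)
  moreover have "\<forall>p q. (\<exists>x \<in> grade_part X q. tpart X p q x \<noteq> 0) \<longrightarrow> p \<le> q"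
    using graded unfolding graded_complex_def by (elim conjE)
  ultimately have "p \<le> q" by blast
  then show ?thesis using q by (metis order_le_imp_less_or_eq)
qed

end

section \<open>Separating bases and the homotopy\<close>

locale separated = graded X
  for X :: "('k::field, 'c::ab_group_add, 'p::order) based_complex" +
  assumes ordered: "ordered_bases X"
    and separating: "\<And>p. separating_basis X p"
begin

definition sep_basis :: "'p \<Rightarrow> int \<Rightarrow> 'c set" where
  "sep_basis p n = fH X p n \<union> fB X p n \<union> fK X p n"

lemma sep_disjoint:
  "fH X p n \<inter> fB X p n = {}" "fH X p n \<inter> fK X p n = {}" "fB X p n \<inter> fK X p n = {}"
  using separating[of p] unfolding separating_basis_def Let_def by blast+

lemma sep_sub: "fH X p n \<subseteq> sep_basis p n" "fB X p n \<subseteq> sep_basis p n" "fK X p n \<subseteq> sep_basis p n"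
  by (auto simp: sep_basis_def)

lemma independent_sep: "independent (sep_basis p n)" and span_sep: "span (sep_basis p n) = summand X p n"
  using separating[of p] unfolding separating_basis_def Let_def basis_of_def sep_basis_def by blast+

lemma span_fB: "span (fB X p n) = bnds X p n"
  using separating[of p] unfolding separating_basis_def Let_def basis_of_def by blast

lemma span_cycles: "span (fH X p n \<union> fB X p n) = cycles X p n"
  using separating[of p] unfolding separating_basis_def Let_def basis_of_def by blast

lemma bij_fK: "bij_betw (tpart X p p) (fK X p n) (fB X p (n - 1))"
  using separating[of p] unfolding separating_basis_def Let_def by blast

lemma pivot_inj: "inj_on (pivot_at X p n) (fH X p n)"
proof -
  have "inj_on (pivot_at X p n) (fH X p n \<union> fB X p n \<union> fK X p n)"
    using separating[of p] unfolding separating_basis_def Let_def by blast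
  then show ?thesis by (rule inj_on_subset) blast
qed

lemma fH_pivot_coord:
  assumes "z \<in> fH X p n" "v \<in> fH X p n"
  shows "representation (bas X p n) v (pivot_at X p n z) = (if v = z then 1 else 0)"
  using separating[of p] assms unfolding separating_basis_def Let_def by auto

lemma fK_pivot_coord:
  assumes "z \<in> fH X p n" "w \<in> fK X p n"
  shows "representation (bas X p n) w (pivot_at X p n z) = 0"
  using separating[of p] assms unfolding separating_basis_def Let_def by blast

lemma independent_bas: "independent (bas X p n)" and span_bas: "span (bas X p n) = summand X p n"
  using ordered unfolding ordered_bases_def basis_of_def by blast+

lemma subspace_bnds: "subspace (bnds X p n)"
  by (metis span_fB subspace_span)

lemma finite_sep: "finite (sep_basis p n)"
  by (rule finite_independent[OF independent_sep])

lemma finite_sub_sep: "U \<subseteq> sep_basis p n \<Longrightarrow> finite U"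
  using finite_sep finite_subset by blast

lemma span_sub_summand: "U \<subseteq> sep_basis p n \<Longrightarrow> x \<in> span U \<Longrightarrow> x \<in> summand X p n"
  using span_mono span_sep by blast

text \<open>
  For \<open>U\<close> one of \<open>\<HH>\<close>, \<open>\<BB>\<close>, \<open>\<KK>\<close>, this is the projection of \<open>C\<^sup>p\<^sub>n\<close> onto
  \<open>\<langle>U\<rangle>\<close> along the span of the other two.
\<close>

definition part :: "'p \<Rightarrow> int \<Rightarrow> 'c set \<Rightarrow> 'c \<Rightarrow> 'c" where
  "part p n U x = (\<Sum>u\<in>U. scl X (representation (sep_basis p n) x u) u)"

lemma part_add:
  "x \<in> summand X p n \<Longrightarrow> y \<in> summand X p n \<Longrightarrow> part p n U (x + y) = part p n U x + part p n U y"
  unfolding part_def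
  by (simp add: representation_add[OF independent_sep] span_sep scale_left_distrib sum.distrib)

lemma part_scale:
  "x \<in> summand X p n \<Longrightarrow> part p n U (scl X a x) = scl X a (part p n U x)"
  unfolding part_def
  by (simp add: representation_scale[OF independent_sep] span_sep scale_sum_right)

lemma part_zero [simp]: "part p n U 0 = 0"
  by (simp add: part_def representation_zero)

lemma part_in_span: "part p n U x \<in> span U"
  unfolding part_def by (intro span_sum span_scale span_base)

lemma part_decomp:
  assumes "x \<in> summand X p n"
  shows "x = part p n (fH X p n) x + part p n (fB X p n) x + part p n (fK X p n) x"
proof -
  let ?f = "\<lambda>u. scl X (representation (sep_basis p n) x u) u"
  note fin = finite_sub_sep[OF sep_sub(1)] finite_sub_sep[OF sep_sub(2)] finite_sub_sep[OF sep_sub(3)]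
  have "x = sum ?f (sep_basis p n)"
    using sum_representation_eq[OF independent_sep _ finite_sep order_refl, of x p n] assms
    by (simp add: span_sep)
  also have "\<dots> = sum ?f (fH X p n \<union> fB X p n) + sum ?f (fK X p n)"
    unfolding sep_basis_def[of p n]
    by (rule sum.union_disjoint) (use fin sep_disjoint[of p n] in auto)
  also have "sum ?f (fH X p n \<union> fB X p n) = sum ?f (fH X p n) + sum ?f (fB X p n)"
    by (rule sum.union_disjoint) (use fin sep_disjoint[of p n] in auto)
  finally show ?thesis by (simp add: part_def)
qed

lemma part_self:
  assumes "U \<subseteq> sep_basis p n" "x \<in> span U"
  shows "part p n U x = x"
proof -
  have "independent U" using independent_sep independent_mono assms(1) by blast
  then show ?thesis
    unfolding part_def representation_extend[OF independent_sep assms(2,1)]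
    by (rule sum_representation_eq[OF _ assms(2) finite_sub_sep[OF assms(1)] order_refl])
qed

lemma part_other:
  assumes "V \<subseteq> sep_basis p n" "x \<in> span V" "U \<inter> V = {}"
  shows "part p n U x = 0"
  unfolding part_def representation_extend[OF independent_sep assms(2,1)]
  using representation_ne_zero assms(3) by (intro sum.neutral) (metis disjoint_iff scale_zero_left)

lemma span_disjoint_zero:
  assumes "U \<subseteq> sep_basis p n" "V \<subseteq> sep_basis p n" "U \<inter> V = {}" "x \<in> span U" "x \<in> span V"
  shows "x = 0"
  using part_self[OF assms(1,4)] part_other[OF assms(2,5,3)] by simp

lemma tpart_cycle: "x \<in> span (fH X p n \<union> fB X p n) \<Longrightarrow> tpart X p p x = 0"
  by (simp add: span_cycles cycles_def)

text \<open>
  A cycle in \<open>\<langle>\<KK>\<rangle>\<close> also lies in \<open>\<langle>\<HH> \<union> \<BB>\<rangle>\<close>, which meets \<open>\<langle>\<KK>\<rangle>\<close>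
  in \<open>0\<close>.
\<close>

lemma tpart_fK_zero:
  assumes "u \<in> span (fK X p n)" "tpart X p p u = 0"
  shows "u = 0"
proof (rule span_disjoint_zero[of "fK X p n" p n "fH X p n \<union> fB X p n"])
  have "u \<in> summand X p n" using span_sub_summand[OF sep_sub(3)] assms(1) .
  then show "u \<in> span (fH X p n \<union> fB X p n)" using assms(2) by (simp add: span_cycles cycles_def)
qed (use assms sep_sub sep_disjoint[of p n] in auto)

lemma zeta_at_eq:
  "zeta_at X p n x =
     (part p n (fH X p n) x +o bnds X p n, part p n (fB X p n) x, tpart X p p (part p n (fK X p n) x))"
proof -
  have "finite (fH X p n)" by (rule finite_sub_sep[OF sep_sub(1)])
  then show ?thesis
    unfolding zeta_at_def Let_def part_def sep_basis_def[symmetric] hsum_def hscale_def hclass_def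
    by (simp add: coset_scale[OF subspace_bnds] coset_sum[OF subspace_bnds]
        linear_sumD[OF linear_tpart] linear_scaleD[OF linear_tpart])
qed

lemma inj_zeta_at: "inj_on (zeta_at X p n) (summand X p n)"
proof (rule inj_onI)
  fix x y assume x: "x \<in> summand X p n" and y: "y \<in> summand X p n"
    and eq: "zeta_at X p n x = zeta_at X p n y"
  let ?D = "\<lambda>U. part p n U x - part p n U y"
  have "?D (fH X p n) \<in> span (fB X p n)"
    using eq by (simp add: zeta_at_eq coset_eq_iff[OF subspace_bnds] span_fB)
  then have H: "?D (fH X p n) = 0"
    using span_disjoint_zero[OF sep_sub(1,2) sep_disjoint(1)] span_diff part_in_span by blast
  have B: "?D (fB X p n) = 0" using eq by (simp add: zeta_at_eq)
  have "tpart X p p (?D (fK X p n)) = 0"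
    using eq by (simp add: zeta_at_eq linear_diffD[OF linear_tpart])
  then have K: "?D (fK X p n) = 0"
    using tpart_fK_zero span_diff part_in_span by blast
  show "x = y" using part_decomp[OF x] part_decomp[OF y] H B K by simp
qed

lemma inj_zeta: "inj (zeta X)"
proof (rule injI)
  fix x y assume eq: "zeta X x = zeta X y"
  show "x = y"
  proof (rule vector_eqI)
    fix p n
    have "zeta_at X p n (component X x p n) = zeta_at X p n (component X y p n)"
      using fun_cong[OF fun_cong[OF eq]] unfolding zeta_def .
    then show "component X x p n = component X y p n"
      using inj_onD[OF inj_zeta_at] component_in by blast
  qed
qed

text \<open>
  Up to sign, \<open>\<gamma>\<close> lifts the boundary part of \<open>x\<close> along the isomorphism
  \<open>t\<^sup>p : \<langle>\<KK>\<rangle> \<rightarrow> \<langle>\<BB>\<rangle>\<close>. This characterization yields linearity without unfolding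
  the inverse of \<open>\<zeta>\<close>.
\<close>

lemma gamma_at_unique:
  assumes "u \<in> span (fK X p (n + 1))" "tpart X p p u = part p n (fB X p n) x"
  shows "gamma_at X p n x = - u"
proof -
  have "zeta_at X p (n + 1) u = (bnds X p (n + 1), 0, part p n (fB X p n) x)"
    using part_self[OF sep_sub(3) assms(1)] assms(2)
      part_other[OF sep_sub(3) assms(1) sep_disjoint(2)]
      part_other[OF sep_sub(3) assms(1) sep_disjoint(3)]
    by (simp add: zeta_at_eq coset_eq_self_iff[OF subspace_bnds] subspace_0[OF subspace_bnds])
  then have "inv_into (summand X p (n + 1)) (zeta_at X p (n + 1))
      (bnds X p (n + 1), 0, part p n (fB X p n) x) = u"
    using inv_into_f_eq[OF inj_zeta_at] span_sub_summand[OF sep_sub(3) assms(1)] by blast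
  then show ?thesis unfolding gamma_at_def by (simp add: zeta_at_eq[of p n])
qed

lemma gamma_at_spec:
  shows "gamma_at X p n x \<in> span (fK X p (n + 1))"
    and "tpart X p p (gamma_at X p n x) = - part p n (fB X p n) x"
proof -
  have "tpart X p p ` fK X p (n + 1) = fB X p n"
    using bij_fK[of p "n + 1"] by (simp add: bij_betw_def)
  moreover have "module_hom (scl X) (scl X) (tpart X p p)"
    using linear_tpart by (simp add: module_hom_iff_linear)
  ultimately have "part p n (fB X p n) x \<in> tpart X p p ` span (fK X p (n + 1))"
    using module_hom.span_image[of "scl X" "scl X" "tpart X p p" "fK X p (n + 1)"] part_in_span by metis
  then obtain u where u: "u \<in> span (fK X p (n + 1))" "tpart X p p u = part p n (fB X p n) x"
    by force
  from gamma_at_unique[OF u] show "gamma_at X p n x \<in> span (fK X p (n + 1))"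
    and "tpart X p p (gamma_at X p n x) = - part p n (fB X p n) x"
    using u by (simp_all add: span_neg linear_negD[OF linear_tpart])
qed

lemma gamma_at_in: "gamma_at X p n x \<in> summand X p (n + 1)"
  by (rule span_sub_summand[OF sep_sub(3) gamma_at_spec(1)])

lemma gamma_at_eqI:
  assumes "u \<in> span (fK X p (n + 1))" "tpart X p p u = - part p n (fB X p n) x"
  shows "gamma_at X p n x = u"
  using gamma_at_unique[of "- u" p n x] assms by (simp add: span_neg linear_negD[OF linear_tpart])

lemma gamma_at_zero: "gamma_at X p n 0 = 0"
  by (rule gamma_at_eqI) (simp_all add: span_zero linear_zeroD[OF linear_tpart])

lemma gamma_at_add:
  assumes "x \<in> summand X p n" "y \<in> summand X p n"
  shows "gamma_at X p n (x + y) = gamma_at X p n x + gamma_at X p n y"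
  by (rule gamma_at_eqI)
    (simp_all add: gamma_at_spec span_add linear_addD[OF linear_tpart] part_add[OF assms])

lemma gamma_at_scale:
  assumes "x \<in> summand X p n"
  shows "gamma_at X p n (scl X a x) = scl X a (gamma_at X p n x)"
  by (rule gamma_at_eqI)
    (simp_all add: gamma_at_spec span_scale linear_scaleD[OF linear_tpart] part_scale[OF assms])

lemma gamma_eq: "gamma X x = (\<Sum>(p, n)\<in>supp. gamma_at X p n (component X x p n))"
  unfolding gamma_def
  by (rule sum.mono_neutral_left)
     (use finite_supp component_outside gamma_at_zero in auto)

lemma component_gamma:
  "component X (gamma X x) p n = gamma_at X p (n - 1) (component X x p (n - 1))"
proof -
  have "component X (gamma X x) p n
      = (\<Sum>(q, m)\<in>supp. component X (gamma_at X q m (component X x q m)) p n)"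
    by (simp add: gamma_eq linear_sumD[OF linear_component] case_prod_unfold)
  also have "\<dots> = component X (gamma_at X p (n - 1) (component X x p (n - 1))) p n"
    by (rule sum_supp_single)
       (auto simp: component_summand[OF gamma_at_in] component_outside gamma_at_zero
         linear_zeroD[OF linear_component])
  also have "\<dots> = gamma_at X p (n - 1) (component X x p (n - 1))"
    by (simp add: component_summand[OF gamma_at_in])
  finally show ?thesis .
qed

lemma linear_gamma: "lin (gamma X)"
  by (rule linearI_field[OF vector_space_scl]; rule vector_eqI)
     (simp_all add: component_gamma linear_addD[OF linear_component]
       linear_scaleD[OF linear_component] gamma_at_add gamma_at_scale)

text \<open>
  The decisive identity: \<open>dhat \<circ> \<gamma>\<close> is minus the projection onto the boundaries, because
  \<open>\<gamma>\<close> chooses preimages of boundaries under \<open>t\<^sup>p\<close>, with the opposite sign.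
\<close>

lemma component_dhat_gamma:
  "component X (dhat X (gamma X x)) p n = - part p n (fB X p n) (component X x p n)"
proof -
  have in_summand: "part q m (fB X q m) y \<in> summand X q m" for q m y
    by (rule span_sub_summand[OF sep_sub(2) part_in_span])
  have "dhat X (gamma X x) = (\<Sum>(q, m)\<in>supp. dhat X (gamma_at X q m (component X x q m)))"
    by (simp add: gamma_eq linear_sumD[OF linear_dhat] case_prod_unfold)
  also have "\<dots> = (\<Sum>(q, m)\<in>supp. - part q m (fB X q m) (component X x q m))"
    by (simp add: dhat_summand[OF gamma_at_in] gamma_at_spec(2))
  finally have "component X (dhat X (gamma X x)) p n
      = (\<Sum>(q, m)\<in>supp. - component X (part q m (fB X q m) (component X x q m)) p n)"
    by (simp add: linear_sumD[OF linear_component] linear_negD[OF linear_component] case_prod_unfold)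
  also have "\<dots> = - component X (part p n (fB X p n) (component X x p n)) p n"
    by (rule sum_supp_single)
       (auto simp: component_summand[OF in_summand] component_outside linear_zeroD[OF linear_component])
  also have "\<dots> = - part p n (fB X p n) (component X x p n)"
    by (simp add: component_summand[OF in_summand])
  finally show ?thesis .
qed

text \<open>
  Since \<open>\<gamma>\<close> preserves the grade and \<open>\<delta>\<close> strictly lowers it, a nonzero fixed vector of
  \<open>\<gamma>\<delta>\<close> would have a nonzero component above each maximal grade that it occupies. So
  \<open>1 - \<gamma>\<delta>\<close> is injective, and in finite dimension surjective; the functional inverse in the
  definition of \<open>\<S>\<close> is then a genuine right inverse.
\<close>

lemma surj_id_minus_gamma_delta: "surj (\<lambda>x. x - gamma X (delta X x))"
proof (rule injective_linear_surj)
  show lin: "lin (\<lambda>x. x - gamma X (delta X x))"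
    by (rule linearI_field[OF vector_space_scl])
       (simp_all add: linear_addD[OF linear_delta] linear_addD[OF linear_gamma]
        linear_scaleD[OF linear_delta] linear_scaleD[OF linear_gamma] scale_right_diff_distrib)
  have "x = 0" if fixed: "x = gamma X (delta X x)" for x
  proof (rule ccontr)
    assume "x \<noteq> 0"
    let ?P = "fst ` {(p, n). component X x p n \<noteq> 0}"
    have "\<exists>p n. component X x p n \<noteq> 0"
      using \<open>x \<noteq> 0\<close> vector_eqI[of x 0] linear_zeroD[OF linear_component] by auto
    then have "?P \<noteq> {}" by auto
    moreover have "finite ?P" using finite_support by blast
    ultimately obtain p where p: "p \<in> ?P" and max: "\<And>q. q \<in> ?P \<Longrightarrow> \<not> p < q"
      using finite_has_maximal[of ?P] by (metis order_less_le)
    from p obtain n where "component X x p n \<noteq> 0" by auto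
    then have "component X (gamma X (delta X x)) p n \<noteq> 0" using fixed by simp
    then have "component X (delta X x) p (n - 1) \<noteq> 0"
      using gamma_at_zero by (metis component_gamma)
    from delta_triangular[OF this] obtain q m where "p < q" "component X x q m \<noteq> 0" by blast
    moreover have "q \<in> ?P" using \<open>component X x q m \<noteq> 0\<close> by force
    ultimately show False using max by blast
  qed
  then show "inj (\<lambda>x. x - gamma X (delta X x))"
    using linear_diffD[OF lin] by (intro injI) (metis (no_types, lifting) eq_iff_diff_eq_0)
qed

section \<open>Pivots in the basis of the complex\<close>

lemma allA_sub: "bas X p n \<subseteq> allA X"
  by (auto simp: allA_def)

lemma bas_summand: "bas X p n \<subseteq> summand X p n"
  by (metis span_bas span_superset)

lemma bas_nonzero: "a \<in> bas X p n \<Longrightarrow> a \<noteq> 0"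
  using dependent_zero[of "bas X p n"] independent_bas[of p n] by auto

lemma bas_disjoint:
  assumes "a \<in> bas X p n" "a \<in> bas X q m" shows "q = p" "m = n"
  using summands_disjoint[of a p n q m] assms bas_summand[of p n] bas_summand[of q m] bas_nonzero
  by auto

lemma independent_allA: "independent (allA X)"
  unfolding allA_def by (rule independent_Union_summands[OF independent_bas bas_summand])

lemma coord_component:
  "a \<in> bas X p n \<Longrightarrow> coord X a v = representation (bas X p n) (component X v p n) a"
  unfolding coord_def allA_def by (rule representation_Union[OF independent_bas span_bas])

lemma fH_summand: "z \<in> fH X p n \<Longrightarrow> z \<in> summand X p n"
  by (rule span_sub_summand[OF sep_sub(1) span_base])

lemma fH_nonzero: "z \<in> fH X p n \<Longrightarrow> z \<noteq> 0"
  using dependent_zero[of "sep_basis p n"] independent_sep[of p n] sep_sub(1)[of p n] by auto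

text \<open>
  Condition (S3) gives the coordinate \<open>1\<close> at the pivot, so the pivot is a genuine basis element
  and not a default value of the description operator.
\<close>

lemma pivot_in_bas: "z \<in> fH X p n \<Longrightarrow> pivot_at X p n z \<in> bas X p n"
  by (rule representation_ne_zero[of _ z]) (simp add: fH_pivot_coord)

text \<open>
  A vector of \<open>C\<^sup>p\<^sub>n\<close> has no coordinates outside \<open>\<AA>\<^sup>p\<^sub>n\<close>, and the orders on the disjoint
  pieces do not interact, so the description operators of the two pivots have the same predicate.
\<close>

lemma rho_eq_pivot:
  assumes "z \<in> fH X p n"
  shows "rho X z = pivot_at X p n z"
proof -
  have "z \<in> span (bas X p n)" using fH_summand[OF assms] by (simp add: span_bas)
  note rep = representation_extend[OF independent_allA this allA_sub]
  have order: "(u', u) \<in> (\<Union>p n. bas_ord X p n) \<longleftrightarrow> (u', u) \<in> bas_ord X p n"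
    if u: "u \<in> bas X p n" for u u'
  proof
    assume "(u', u) \<in> (\<Union>p n. bas_ord X p n)"
    then obtain q m where qm: "(u', u) \<in> bas_ord X q m" by blast
    moreover have "linear_order_on (bas X q m) (bas_ord X q m)"
      using ordered unfolding ordered_bases_def by blast
    ultimately have "u \<in> bas X q m"
      unfolding linear_order_on_def partial_order_on_def preorder_on_def refl_on_def by blast
    then have "q = p" "m = n" by (rule bas_disjoint[OF u])+
    then show "(u', u) \<in> bas_ord X p n" using qm by simp
  qed blast
  have "(u \<in> allA X \<and> representation (allA X) z u \<noteq> 0 \<and>
        (\<forall>u'\<in>allA X. representation (allA X) z u' \<noteq> 0 \<longrightarrow> (u', u) \<in> (\<Union>p n. bas_ord X p n)))
     \<longleftrightarrow> (u \<in> bas X p n \<and> representation (bas X p n) z u \<noteq> 0 \<and>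
        (\<forall>u'\<in>bas X p n. representation (bas X p n) z u' \<noteq> 0 \<longrightarrow> (u', u) \<in> bas_ord X p n))" for u
  proof (cases "representation (bas X p n) z u = 0")
    case False
    then have u: "u \<in> bas X p n" by (rule representation_ne_zero)
    have "(\<forall>u'\<in>allA X. representation (bas X p n) z u' \<noteq> 0 \<longrightarrow> (u', u) \<in> bas_ord X p n)
      \<longleftrightarrow> (\<forall>u'\<in>bas X p n. representation (bas X p n) z u' \<noteq> 0 \<longrightarrow> (u', u) \<in> bas_ord X p n)"
      using representation_ne_zero allA_sub by blast
    then show ?thesis
      unfolding rep order[OF u] using u allA_sub by auto
  qed (simp add: rep)
  then show ?thesis unfolding rho_def pivot_def by presburger
qed

lemma allH_obtain:
  assumes "z \<in> allH X" obtains p n where "z \<in> fH X p n"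
  using assms unfolding allH_def by blast

lemma fH_allH: "z \<in> fH X p n \<Longrightarrow> z \<in> allH X"
  by (auto simp: allH_def)

lemma rho_inj: "inj_on (rho X) (allH X)"
proof (rule inj_onI)
  fix z z' assume z: "z \<in> allH X" and z': "z' \<in> allH X" and eq: "rho X z = rho X z'"
  from z obtain p n where zp: "z \<in> fH X p n" by (rule allH_obtain)
  from z' obtain q m where zq: "z' \<in> fH X q m" by (rule allH_obtain)
  have a: "rho X z \<in> bas X p n" using pivot_in_bas[OF zp] rho_eq_pivot[OF zp] by simp
  have b: "rho X z \<in> bas X q m" using pivot_in_bas[OF zq] rho_eq_pivot[OF zq] eq by simp
  have "q = p" "m = n" by (rule bas_disjoint[OF a b])+
  then show "z = z'"
    using inj_onD[OF pivot_inj] zp zq eq rho_eq_pivot by metis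
qed

section \<open>Coordinates in the Conley complex\<close>

lemma independent_allH: "independent (allH X)"
  unfolding allH_def
  by (rule independent_Union_summands)
     (use independent_mono[OF independent_sep sep_sub(1)] fH_summand in auto)

lemma finite_allH: "finite (allH X)"
  by (rule finite_independent[OF independent_allH])

lemma component_allH:
  assumes "z \<in> allH X"
  shows "component X z p n = (if z \<in> fH X p n then z else 0)"
proof -
  from assms obtain q m where z: "z \<in> fH X q m" by (rule allH_obtain)
  have "p = q \<and> n = m" if "z \<in> fH X p n"
    using summands_disjoint[OF fH_summand[OF z] fH_summand[OF that] fH_nonzero[OF z]] by blast
  then show ?thesis
    using component_summand[OF fH_summand[OF z], of p n] z by metis
qed

text \<open>
  As \<open>z\<close> has a single nonzero component, which lies in some \<open>\<HH>\<^sup>p\<^sub>n\<close>, the \<open>B\<close>- and \<open>K\<close>-parts of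
  \<open>\<zeta>(z)\<close> vanish, and the family of homology classes of its components is the required one.
\<close>

lemma zeta_bar_spec:
  assumes "z \<in> allH X"
  shows "zeta_bar X z = (\<lambda>p n. component X z p n +o bnds X p n)"
    and "bar_incl (zeta_bar X z) = zeta X z"
proof -
  let ?h = "\<lambda>p n. component X z p n +o bnds X p n"
  have comp_span: "component X z p n \<in> span (fH X p n)" for p n
    by (simp add: component_allH[OF assms] span_base span_zero)
  have incl: "bar_incl ?h = zeta X z"
    unfolding bar_incl_def zeta_def
    using part_self[OF sep_sub(1) comp_span]
      part_other[OF sep_sub(1) comp_span, of "fB X _ _"] part_other[OF sep_sub(1) comp_span, of "fK X _ _"]
      sep_disjoint
    by (auto simp: zeta_at_eq fun_eq_iff Int_commute linear_zeroD[OF linear_tpart])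
  have "?h \<in> conley_space X"
  proof -
    have "component X z p n \<in> cycles X p n" for p n
      using comp_span[of p n] span_mono[of "fH X p n" "fH X p n \<union> fB X p n"]
      by (auto simp: span_cycles)
    moreover have "{(p, n). ?h p n \<noteq> bnds X p n} \<subseteq> {(p, n). component X z p n \<noteq> 0}"
      using subspace_0[OF subspace_bnds] by (auto simp: coset_eq_self_iff[OF subspace_bnds])
    ultimately show ?thesis
      using finite_subset[OF _ finite_support[of z]]
      by (auto simp: conley_space_def homology_def hclass_def)
  qed
  moreover have "h = h'" if "bar_incl h = bar_incl h'" for h h' :: "('c, 'p) hfamily"
    using that by (auto simp: bar_incl_def fun_eq_iff)
  ultimately show "zeta_bar X z = ?h"
    unfolding zeta_bar_def using incl by (intro the_equality) (blast, metis)
  then show "bar_incl (zeta_bar X z) = zeta X z" using incl by simp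
qed

lemma beta_zeta_bar: "z \<in> allH X \<Longrightarrow> beta X (zeta_bar X z) = z"
  by (simp add: beta_def zeta_bar_spec(2) inv_f_f[OF inj_zeta])

lemma bar_scale_zeta_bar:
  "z \<in> allH X \<Longrightarrow> bar_scale X a (zeta_bar X z) = (\<lambda>p n. scl X a (component X z p n) +o bnds X p n)"
  by (simp add: bar_scale_def hscale_def zeta_bar_spec(1) coset_scale[OF subspace_bnds])

lemma bar_sum_zeta_bar:
  "bar_sum X (\<lambda>z. bar_scale X (c z) (zeta_bar X z)) (allH X)
     = (\<lambda>p n. (\<Sum>z\<in>fH X p n. scl X (c z) z) +o bnds X p n)"
proof (intro ext)
  fix p n
  have "bar_sum X (\<lambda>z. bar_scale X (c z) (zeta_bar X z)) (allH X) p n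
      = bnds X p n + (\<Sum>z\<in>allH X. scl X (c z) (component X z p n) +o bnds X p n)"
    unfolding bar_sum_def hsum_def by (simp add: bar_scale_zeta_bar)
  also have "\<dots> = (\<Sum>z\<in>allH X. scl X (c z) (component X z p n)) +o bnds X p n"
    by (rule coset_sum[OF subspace_bnds finite_allH])
  also have "(\<Sum>z\<in>allH X. scl X (c z) (component X z p n))
      = (\<Sum>z\<in>fH X p n. scl X (c z) (component X z p n))"
    by (rule sum.mono_neutral_right[OF finite_allH]) (auto simp: component_allH fH_allH)
  also have "\<dots> = (\<Sum>z\<in>fH X p n. scl X (c z) z)"
    by (rule sum.cong) (auto simp: component_allH fH_allH)
  finally show "bar_sum X (\<lambda>z. bar_scale X (c z) (zeta_bar X z)) (allH X) p n
      = (\<Sum>z\<in>fH X p n. scl X (c z) z) +o bnds X p n" .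
qed

text \<open>
  The classes of \<open>\<HH>\<^sup>p\<^sub>n\<close> are independent modulo \<open>B\<^sup>p\<^sub>n = \<langle>\<BB>\<^sup>p\<^sub>n\<rangle>\<close>, so a family has at most one
  coordinate function in \<open>\<zeta>(\<HH>)\<close>.
\<close>

lemma bar_coords_bar_sum:
  assumes "\<And>z. z \<notin> allH X \<Longrightarrow> c z = 0"
  shows "bar_coords X (bar_sum X (\<lambda>z. bar_scale X (c z) (zeta_bar X z)) (allH X)) = c"
  unfolding bar_coords_def
proof (rule the_equality)
  fix c'
  assume c': "(\<forall>z. z \<notin> allH X \<longrightarrow> c' z = 0) \<and>
    bar_sum X (\<lambda>z. bar_scale X (c z) (zeta_bar X z)) (allH X)
      = bar_sum X (\<lambda>z. bar_scale X (c' z) (zeta_bar X z)) (allH X)"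
  show "c' = c"
  proof
    fix z
    show "c' z = c z"
    proof (cases "z \<in> allH X")
      case True
      then obtain p n where z: "z \<in> fH X p n" by (rule allH_obtain)
      let ?D = "\<Sum>z\<in>fH X p n. scl X (c' z - c z) z"
      have D: "?D = (\<Sum>z\<in>fH X p n. scl X (c' z) z) - (\<Sum>z\<in>fH X p n. scl X (c z) z)"
        by (simp add: scale_left_diff_distrib sum_subtractf)
      have "(\<Sum>z\<in>fH X p n. scl X (c z) z) +o bnds X p n = (\<Sum>z\<in>fH X p n. scl X (c' z) z) +o bnds X p n"
        using conjunct2[OF c'] unfolding bar_sum_zeta_bar by (rule fun_cong[OF fun_cong])
      then have "?D \<in> span (fB X p n)"
        unfolding D span_fB using coset_eq_iff[OF subspace_bnds] by metis
      moreover have "?D \<in> span (fH X p n)" by (intro span_sum span_scale span_base)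
      ultimately have "?D = 0"
        using span_disjoint_zero[OF sep_sub(1,2) sep_disjoint(1)] by blast
      then have "c' z - c z = 0"
        using independentD[OF independent_mono[OF independent_sep sep_sub(1)[of p n]]
            finite_sub_sep[OF sep_sub(1)] order_refl, of "\<lambda>z. c' z - c z" z] z by simp
      then show ?thesis by simp
    qed (use assms c' in simp)
  qed
qed (use assms in simp)

text \<open>
  The value \<open>0\<close> off \<open>\<HH>\<close> matches the convention for coordinate functions in \<open>bar_coords\<close>.
\<close>

definition hcoeff :: "'c \<Rightarrow> 'c \<Rightarrow> 'k" where
  "hcoeff v z = (if z \<in> allH X then representation (\<Union>p n. sep_basis p n) v z else 0)"

lemma hcoeff_eq: "z \<in> fH X p n \<Longrightarrow> hcoeff v z = representation (sep_basis p n) (component X v p n) z"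
  unfolding hcoeff_def
  using representation_Union[OF independent_sep span_sep, of z p n v] sep_sub(1)[of p n]
  by (simp add: fH_allH subset_iff)

lemma alpha_eq:
  "alpha X v = bar_sum X (\<lambda>z. bar_scale X (hcoeff v z) (zeta_bar X z)) (allH X)"
  unfolding bar_sum_zeta_bar alpha_def zeta_def
  by (simp add: zeta_at_eq part_def hcoeff_eq cong: sum.cong)

lemma bar_coords_alpha: "bar_coords X (alpha X v) = hcoeff v"
  unfolding alpha_eq by (rule bar_coords_bar_sum) (simp add: hcoeff_def)

section \<open>Reading off the connection matrix\<close>

text \<open>
  Conditions (S2) and (S3) say that, among the vectors of \<open>\<HH>\<close> and \<open>\<KK>\<close>, only \<open>z\<close> itself
  has a nonzero coordinate at the pivot of \<open>z\<close>, and that this coordinate is \<open>1\<close>. Hence, once the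
  \<open>B\<close>-part is removed, the pivot coordinate is the coefficient of \<open>z\<close>.
\<close>

lemma coord_pivot:
  assumes z: "z \<in> fH X p n" and y: "y \<in> summand X p n"
  shows "representation (bas X p n) (part p n (fH X p n) y + part p n (fK X p n) y) (pivot_at X p n z)
    = representation (sep_basis p n) y z"
proof -
  let ?r = "\<lambda>x. representation (bas X p n) x (pivot_at X p n z)"
  have span: "u \<in> span (bas X p n)" if "u \<in> sep_basis p n" for u
    using that span_superset[of "sep_basis p n"] by (auto simp: span_bas span_sep)
  have r_part: "?r (part p n U y) = (\<Sum>u\<in>U. representation (sep_basis p n) y u * ?r u)"
    if "U \<subseteq> sep_basis p n" for U
    unfolding part_def using that span
    by (simp add: representation_sum[OF independent_bas] representation_scale[OF independent_bas]
        span_scale subset_iff)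
  have in_span: "part p n U y \<in> span (bas X p n)" if "U \<subseteq> sep_basis p n" for U
    using span_sub_summand[OF that part_in_span] by (simp add: span_bas)
  have "?r (part p n (fH X p n) y + part p n (fK X p n) y)
      = (\<Sum>u\<in>fH X p n. representation (sep_basis p n) y u * ?r u)
        + (\<Sum>u\<in>fK X p n. representation (sep_basis p n) y u * ?r u)"
    by (simp add: representation_add[OF independent_bas in_span in_span] r_part sep_sub)
  also have "(\<Sum>u\<in>fK X p n. representation (sep_basis p n) y u * ?r u) = 0"
    by (rule sum.neutral) (simp add: fK_pivot_coord[OF z])
  also have "(\<Sum>u\<in>fH X p n. representation (sep_basis p n) y u * ?r u)
      = (\<Sum>u\<in>fH X p n. if u = z then representation (sep_basis p n) y z else 0)"
    by (rule sum.cong) (auto simp: fH_pivot_coord[OF z])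
  also have "\<dots> = representation (sep_basis p n) y z"
    using z finite_sub_sep[OF sep_sub(1)] by simp
  finally show ?thesis by simp
qed

text \<open>
  With \<open>x = (1 - \<gamma>\<delta>)\<^bsup>-1\<^esup> y\<close> one has \<open>\<S> y = \<delta> x\<close>, and \<open>x - \<gamma>\<delta> x = y\<close> reads
  \<open>x = (1 + \<gamma>\<S>) y\<close>.
\<close>

lemma Sop_eq_delta: "Sop X y = delta X (y + gamma X (Sop X y))"
proof -
  let ?x = "inv (\<lambda>x. x - gamma X (delta X x)) y"
  have "?x - gamma X (delta X ?x) = y"
    using surj_f_inv_f[OF surj_id_minus_gamma_delta] .
  moreover have S: "Sop X y = delta X ?x" by (simp add: Sop_def)
  ultimately have eq: "y + gamma X (Sop X y) = ?x" by (simp add: algebra_simps)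
  show ?thesis unfolding eq by (rule S)
qed

lemma dhat_fH:
  assumes "z \<in> allH X" shows "dhat X z = 0"
proof -
  from assms obtain p n where z: "z \<in> fH X p n" by (rule allH_obtain)
  then show ?thesis
    using dhat_summand[OF fH_summand[OF z]] tpart_cycle[of z p n] by (simp add: span_base)
qed

text \<open>
  Splitting \<open>d = \<delta> + dhat\<close> gives
  \<open>d(1 + \<gamma>\<S>) z = \<S> z + dhat z + dhat \<gamma> \<S> z\<close>. The middle term vanishes and the last one cancels
  the boundary part of \<open>\<S> z\<close>.
\<close>

lemma component_diff_perturbed:
  assumes "z \<in> allH X"
  shows "component X (diff X (z + gamma X (Sop X z))) p n
    = part p n (fH X p n) (component X (Sop X z) p n) + part p n (fK X p n) (component X (Sop X z) p n)"
proof -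
  let ?S = "Sop X z" and ?x = "z + gamma X (Sop X z)"
  have "diff X ?x = delta X ?x + dhat X ?x" by (simp add: delta_def)
  also have "\<dots> = ?S + dhat X (gamma X ?S)"
    using Sop_eq_delta[of z] by (simp add: linear_addD[OF linear_dhat] dhat_fH[OF assms])
  finally have eq: "component X (diff X ?x) p n
      = component X ?S p n - part p n (fB X p n) (component X ?S p n)"
    by (simp add: linear_addD[OF linear_component] component_dhat_gamma)
  have "component X ?S p n - part p n (fB X p n) (component X ?S p n)
      = part p n (fH X p n) (component X ?S p n) + part p n (fK X p n) (component X ?S p n)"
    by (subst part_decomp[OF component_in]) (simp add: algebra_simps)
  then show ?thesis using eq by simp
qed

lemma connection_matrix_eq_coord:
  assumes zi: "z\<^sub>i \<in> allH X" and zj: "z\<^sub>j \<in> allH X"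
  shows "connection_matrix X z\<^sub>i z\<^sub>j = coord X (rho X z\<^sub>i) (diff X (z\<^sub>j + gamma X (Sop X z\<^sub>j)))"
proof -
  from zi obtain p n where z: "z\<^sub>i \<in> fH X p n" by (rule allH_obtain)
  have "connection_matrix X z\<^sub>i z\<^sub>j = hcoeff (Sop X z\<^sub>j) z\<^sub>i"
    by (simp add: connection_matrix_def dbar_def beta_zeta_bar[OF zj] bar_coords_alpha)
  also have "\<dots> = representation (sep_basis p n) (component X (Sop X z\<^sub>j) p n) z\<^sub>i"
    by (rule hcoeff_eq[OF z])
  also have "\<dots> = representation (bas X p n)
      (component X (diff X (z\<^sub>j + gamma X (Sop X z\<^sub>j))) p n) (rho X z\<^sub>i)"
    by (simp add: component_diff_perturbed[OF zj] rho_eq_pivot[OF z] coord_pivot[OF z])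
  also have "\<dots> = coord X (rho X z\<^sub>i) (diff X (z\<^sub>j + gamma X (Sop X z\<^sub>j)))"
    by (rule coord_component[symmetric]) (simp add: rho_eq_pivot[OF z] pivot_in_bas[OF z])
  finally show ?thesis .
qed

text \<open>
  The pivots are elements of the basis \<open>\<AA>\<close>, hence independent, and distinct elements of
  \<open>\<HH>\<close> have distinct pivots, so the coordinates of \<open>a \<rho>(z)\<close> in \<open>\<rho>(\<HH>)\<close> are
  concentrated at \<open>z\<close>.
\<close>

lemma theta_scale_rho:
  assumes "z \<in> allH X"
  shows "theta X (scl X a (rho X z)) = bar_scale X a (zeta_bar X z)"
proof -
  have "rho X ` allH X \<subseteq> allA X"
    using pivot_in_bas rho_eq_pivot allA_sub by (force elim!: allH_obtain)
  then have ind: "independent (rho X ` allH X)"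
    using independent_allA independent_mono by blast
  have rep: "representation (rho X ` allH X) (scl X a (rho X z)) (rho X z') = (if z' = z then a else 0)"
    if "z' \<in> allH X" for z'
    using that assms inj_onD[OF rho_inj, of z' z]
    by (auto simp: representation_scale[OF ind] span_base representation_basis[OF ind])
  have coset: "(\<Sum>z'\<in>fH X p n.
      scl X (representation (rho X ` allH X) (scl X a (rho X z)) (rho X z')) z') = scl X a (component X z p n)"
    for p n
  proof -
    have "(\<Sum>z'\<in>fH X p n. scl X (representation (rho X ` allH X) (scl X a (rho X z)) (rho X z')) z')
      = (\<Sum>z'\<in>fH X p n. if z' = z then scl X a z else 0)"
      by (rule sum.cong) (auto simp: rep fH_allH)
    then show ?thesis
      using finite_sub_sep[OF sep_sub(1)[of p n]] by (simp add: component_allH[OF assms])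
  qed
  show ?thesis
    unfolding theta_def bar_sum_zeta_bar coset bar_scale_zeta_bar[OF assms] ..
qed

end

theorem corollary4p9:
  fixes X :: "('k::field, 'c::ab_group_add, 'p::order) based_complex"
    and z\<^sub>i z\<^sub>j :: 'c
  assumes "wfp ((<) :: 'p \<Rightarrow> 'p \<Rightarrow> bool)"
    and "graded_complex X"
    and "ordered_bases X"
    and "\<forall>p. separating_basis X p"
    and "z\<^sub>i \<in> allH X" and "z\<^sub>j \<in> allH X"
  shows "bar_scale X (connection_matrix X z\<^sub>i z\<^sub>j) (zeta_bar X z\<^sub>i) =
           theta X (coord_proj X (rho X z\<^sub>i)
             (diff X ((\<lambda>x. x + gamma X (Sop X x)) (beta X (zeta_bar X z\<^sub>j)))))
       \<and> connection_matrix X z\<^sub>i z\<^sub>j =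
           coord X (rho X z\<^sub>i)
             (diff X ((\<lambda>x. x + gamma X (Sop X x)) (beta X (zeta_bar X z\<^sub>j))))"
proof -
  interpret separated X
    by unfold_locales (use assms in auto)
  have "connection_matrix X z\<^sub>i z\<^sub>j =
      coord X (rho X z\<^sub>i) (diff X ((\<lambda>x. x + gamma X (Sop X x)) (beta X (zeta_bar X z\<^sub>j))))"
    using connection_matrix_eq_coord[OF assms(5,6)] by (simp add: beta_zeta_bar[OF assms(6)])
  then show ?thesis
    using theta_scale_rho[OF assms(5)] by (simp add: coord_proj_def)
qed

end
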